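(* Let $P^n$ be an $n$-dimensional simple convex polytope which is $n$-colorable, and fix a proper coloring $h$ of its facets by the $n$ colors $[n]=\{1,\dots,n\}$. Suppose that $P^n=\bigcup_{i=1}^N X_i$ is covered by a finite family of closed sets $X_1,\dots,X_N$ such that each point $x\in P^n$ is covered by no more than $n$ of the sets $X_j$. Then for some $i$, a connected component of $X_i$ intersects at least two distinct facets of $P^n$ of the same color.
   Context: An $n$-dimensional convex polytope is simple if exactly $n$ facets (codimension-one faces) meet at each vertex. Let $F_1,\dots,F_m$ be the facets of a simple polytope $P^n$. A proper coloring of $P^n$ by $k$ colors is a map $h:\{F_1,\dots,F_m\}\to[k]=\{1,\dots,k\}$ such that $h(F_i)\ne h(F_j)$ whenever $F_i\neq F_j$ are adjacent, i.e. $F_i\cap F_j$ is a face of codimension $2$ (equivalently, for a simple polytope, $F_i\cap F_j\neq\emptyset$). $P^n$ is $n$-colorable if it admits a proper coloring by $n$ colors. *)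

theory Defs
  imports "HOL-Analysis.Analysis"
begin

text \<open>
  Polytopes live in an arbitrary Euclidean space, which may have larger dimension than the
  polytope; the dimension of a polytope is its affine dimension, and its vertices are its
  extreme points.
\<close>

definition simple_polytope :: "nat \<Rightarrow> 'a::euclidean_space set \<Rightarrow> bool" where
  "simple_polytope n P \<longleftrightarrow>
     polytope P \<and> aff_dim P = int n \<and>
     (\<forall>v. v extreme_point_of P \<longrightarrow> card {F. F facet_of P \<and> v \<in> F} = n)"

text \<open>
  The library counts the empty set as a face, of affine dimension \<open>-1\<close>. The condition
  \<open>F \<inter> G \<noteq> {}\<close> keeps the two disjoint end points of a segment from being adjacent.
\<close>

definition adjacent_facets :: "'a::euclidean_space set \<Rightarrow> 'a set \<Rightarrow> 'a set \<Rightarrow> bool" where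
  "adjacent_facets P F G \<longleftrightarrow>
     F facet_of P \<and> G facet_of P \<and> F \<noteq> G \<and>
     F \<inter> G \<noteq> {} \<and> (F \<inter> G) face_of P \<and> aff_dim (F \<inter> G) = aff_dim P - 2"

definition proper_coloring :: "'a::euclidean_space set \<Rightarrow> nat \<Rightarrow> ('a set \<Rightarrow> nat) \<Rightarrow> bool" where
  "proper_coloring P k h \<longleftrightarrow>
     h \<in> {F. F facet_of P} \<rightarrow> {1..k} \<and>
     (\<forall>F G. adjacent_facets P F G \<longrightarrow> h F \<noteq> h G)"

end

theory Submission
  imports Defs
begin

text \<open>
  Fix a vertex \<open>v\<close>. Since facets of the same colour are disjoint, each colour occurs exactly once
  among the \<open>n\<close> facets through \<open>v\<close>. Suppose that no component of an \<open>X\<^sub>i\<close> meets two facets of the same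
  colour. Cut the \<open>X\<^sub>i\<close> into clopen pieces \<open>Y\<^sub>j\<close> with the same property, and map \<open>P\<close> to the affine
  hull of \<open>P\<close> by a partition of unity close to the \<open>Y\<^sub>j\<close>, sending piece \<open>j\<close> to the point \<open>e\<^sub>j\<close> whose
  distance coordinate from a facet \<open>F \<ni> v\<close> is \<open>0\<close> if \<open>Y\<^sub>j\<close> meets \<open>F\<close> and \<open>1\<close> otherwise. At most \<open>n\<close> of
  the \<open>e\<^sub>j\<close> are involved at any point, so the map misses some \<open>q\<close> with all coordinates in \<open>(0,1)\<close>.
  On \<open>F\<close> the coordinate of \<open>F\<close> is \<open>0\<close> and on the other facets of the colour of \<open>F\<close> it is \<open>1\<close>, so on
  the boundary the map minus \<open>q\<close> is never opposite to \<open>x - x\<^sub>0\<close>, for \<open>x\<^sub>0\<close> interior and close to \<open>v\<close>;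
  projecting its negative radially from \<open>x\<^sub>0\<close> to the boundary contradicts Brouwer's theorem.
\<close>

section \<open>Vectors orthogonal to a small family\<close>

text \<open>Replacing each element of \<open>A\<close> by its orthogonal projection to
  \<open>D\<close> leaves its inner products with vectors of \<open>D\<close> unchanged. The fewer
  than \<open>dim D\<close> projections span a proper subspace of \<open>D\<close>, so some nonzero
  vector of \<open>D\<close> is orthogonal to all of them.\<close>

lemma exists_nonzero_orthogonal_in_subspace:
  fixes D A :: "'a::euclidean_space set"
  assumes "subspace D" "finite A" "card A < dim D"
  obtains u where "u \<in> D" "u \<noteq> 0" "\<And>a. a \<in> A \<Longrightarrow> a \<bullet> u = 0"
proof -
  have spanD: "span D = D"
    using assms(1) by simp
  have "\<exists>y z. y \<in> D \<and> (\<forall>w\<in>D. orthogonal z w) \<and> a = y + z" for a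
    using orthogonal_subspace_decomp_exists[of D a] spanD by metis
  then obtain y z where yz: "\<And>a. y a \<in> D" "\<And>a w. w \<in> D \<Longrightarrow> orthogonal (z a) w"
    "\<And>a. a = y a + z a"
    by metis
  have "span (y ` A) \<subseteq> span D"
    using yz(1) by (intro span_mono) auto
  moreover have "dim (y ` A) < dim D"
    using assms(2,3) card_image_le[of A y] dim_le_card'[of "y ` A"] by simp
  ultimately have "span (y ` A) \<subset> span D"
    by (metis dim_span less_irrefl psubsetI)
  then obtain u where u: "u \<noteq> 0" "u \<in> span D" "\<And>v. v \<in> span (y ` A) \<Longrightarrow> orthogonal u v"
    using orthogonal_to_subspace_exists_gen by metis
  show thesis
  proof
    show "u \<in> D" "u \<noteq> 0"
      using u spanD by auto
    fix a assume "a \<in> A"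
    then have "y a \<bullet> u = 0"
      using u(3)[of "y a"] by (simp add: span_base orthogonal_def inner_commute)
    moreover have "z a \<bullet> u = 0"
      using yz(2) u(2) spanD by (simp add: orthogonal_def)
    ultimately show "a \<bullet> u = 0"
      using yz(3)[of a] by (metis add.right_neutral inner_add_left)
  qed
qed

section \<open>Radial projection and Brouwer's theorem\<close>

text \<open>Each ray from a relatively interior point within the affine hull crosses the relative
  frontier exactly once, and projection along rays to a compact surface with this property is
  continuous. The factor \<open>k l\<close> stretches the direction \<open>l\<close> until it
  reaches the frontier.\<close>

lemma continuous_radial_projection:
  fixes S :: "'a::euclidean_space set"
  assumes "compact S" "convex S" and a: "a \<in> rel_interior S"
  obtains k :: "'a \<Rightarrow> real" where
    "continuous_on {l. a + l \<in> affine hull S \<and> l \<noteq> 0} (\<lambda>l. k l *\<^sub>R l)"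
    "\<And>l. a + l \<in> affine hull S \<Longrightarrow> l \<noteq> 0 \<Longrightarrow> 0 < k l \<and> a + k l *\<^sub>R l \<in> rel_frontier S"
proof -
  have bdd: "bounded S" and clo: "closed S"
    using assms(1) by (simp_all add: compact_imp_bounded compact_imp_closed)
  have "\<exists>d>0. a + d *\<^sub>R l \<in> rel_frontier S \<and> (\<forall>e. 0 \<le> e \<and> e < d \<longrightarrow> a + e *\<^sub>R l \<in> rel_interior S)"
    if "a + l \<in> affine hull S" "l \<noteq> 0" for l
    using ray_to_rel_frontier [OF bdd a] that by metis
  then obtain k where k1: "\<And>l. \<lbrakk>a + l \<in> affine hull S; l \<noteq> 0\<rbrakk> \<Longrightarrow> 0 < k l \<and> a + k l *\<^sub>R l \<in> rel_frontier S"
      and k2: "\<And>l e. \<lbrakk>a + l \<in> affine hull S; l \<noteq> 0; 0 \<le> e; e < k l\<rbrakk> \<Longrightarrow> a + e *\<^sub>R l \<in> rel_interior S"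
    by metis
  have aff: "a \<in> affine hull S"
    by (meson a hull_inc rel_interior_subset subsetD)
  define V where "V = (\<lambda>x. x - a) ` (affine hull S)"
  have Veq: "V = {l. a + l \<in> affine hull S}"
    unfolding V_def by (force simp: image_iff)
  have sub: "subspace V"
    unfolding V_def by (rule affine_diffs_subspace_subtract[OF affine_affine_hull aff])
  \<comment> \<open>Translating the frontier by \<open>- a\<close> turns rays from \<open>a\<close>
    into rays of the linear space \<open>V\<close>.\<close>
  define T where "T = {l. a + l \<in> rel_frontier S}"
  have Teq: "T = (\<lambda>x. - a + x) ` rel_frontier S"
  proof (intro subset_antisym subsetI)
    fix l assume "l \<in> T"
    then show "l \<in> (\<lambda>x. - a + x) ` rel_frontier S"
      by (intro image_eqI[of _ _ "a + l"]) (auto simp: T_def)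
  qed (auto simp: T_def)
  have "continuous_on (V - {0}) (\<lambda>l. k l *\<^sub>R l)"
  proof (rule continuous_on_compact_surface_projection)
    show "compact T"
      unfolding Teq by (rule compact_translation[OF compact_rel_frontier_bounded[OF bdd]])
    have "rel_frontier S \<subseteq> affine hull S"
      using clo hull_subset[of S affine] by (auto simp: rel_frontier_def)
    moreover have "a \<notin> rel_frontier S"
      using a by (simp add: rel_frontier_def)
    ultimately show "T \<subseteq> V - {0}"
      by (auto simp: T_def Veq)
    show "cone V"
      by (rule subspace_imp_cone[OF sub])
    show "(0 < e \<and> e *\<^sub>R l \<in> T) \<longleftrightarrow> k l = e" if l: "l \<in> V - {0}" for l e
    proof
      assume e: "0 < e \<and> e *\<^sub>R l \<in> T"
      have lV: "a + l \<in> affine hull S" "l \<noteq> 0"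
        using l by (auto simp: Veq)
      have "\<not> e < k l"
        using e k2[OF lV, of e] by (auto simp: T_def rel_frontier_def)
      \<comment> \<open>A second crossing further out would put the first one on an open segment
        from \<open>a\<close> to a point of the closure, hence in the relative interior.\<close>
      moreover have "\<not> k l < e"
      proof
        assume less: "k l < e"
        have "a + e *\<^sub>R l \<in> closure S"
          using e by (simp add: T_def rel_frontier_def)
        then have sub: "open_segment a (a + e *\<^sub>R l) \<subseteq> rel_interior S"
          using rel_interior_closure_convex_segment[OF assms(2) a] by blast
        have "a + k l *\<^sub>R l = (1 - k l / e) *\<^sub>R a + (k l / e) *\<^sub>R (a + e *\<^sub>R l)"
          using e by (simp add: algebra_simps)
        then have "a + k l *\<^sub>R l \<in> open_segment a (a + e *\<^sub>R l)"
          unfolding in_segment using e less k1[OF lV] lV(2)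
          by (auto intro!: exI[of _ "k l / e"])
        then show False
          using sub k1[OF lV] by (auto simp: rel_frontier_def)
      qed
      ultimately show "k l = e" by simp
    next
      assume "k l = e"
      then show "0 < e \<and> e *\<^sub>R l \<in> T"
        using k1[of l] l by (auto simp: T_def Veq)
    qed
  qed
  moreover have "V - {0} = {l. a + l \<in> affine hull S \<and> l \<noteq> 0}"
    by (auto simp: Veq)
  ultimately show thesis
    using that[of k] k1 by auto
qed

text \<open>Brouwer's theorem applies to the map that sends \<open>x\<close> to the frontier point
  in direction \<open>w x\<close> from \<open>a\<close>. All its values lie on the relative
  frontier, so its fixed point does too.\<close>

lemma nonvanishing_field_radial_on_frontier:
  fixes S :: "'a::euclidean_space set" and w :: "'a \<Rightarrow> 'a"
  assumes "compact S" "convex S" and a: "a \<in> rel_interior S" and cont: "continuous_on S w"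
    and dir: "\<And>x. x \<in> S \<Longrightarrow> a + w x \<in> affine hull S" and nz: "\<And>x. x \<in> S \<Longrightarrow> w x \<noteq> 0"
  obtains x s where "x \<in> rel_frontier S" "0 < s" "x = a + s *\<^sub>R w x"
proof -
  obtain k where
    k: "continuous_on {l. a + l \<in> affine hull S \<and> l \<noteq> 0} (\<lambda>l. k l *\<^sub>R l)"
    "\<And>l. a + l \<in> affine hull S \<Longrightarrow> l \<noteq> 0 \<Longrightarrow> 0 < k l \<and> a + k l *\<^sub>R l \<in> rel_frontier S"
    by (rule continuous_radial_projection[OF assms(1-3)]) (rule that)
  have front: "rel_frontier S \<subseteq> S"
    using assms(1) by (metis Diff_subset closure_closed compact_imp_closed rel_frontier_def)
  have cont': "continuous_on S (\<lambda>x. a + k (w x) *\<^sub>R w x)"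
    by (intro continuous_on_add continuous_on_const continuous_on_compose2[OF k(1) cont])
      (use dir nz in auto)
  have maps: "(\<lambda>x. a + k (w x) *\<^sub>R w x) \<in> S \<rightarrow> S"
    using k(2) dir nz front by blast
  have "S \<noteq> {}"
    using a rel_interior_subset by blast
  then obtain x where "x \<in> S" "a + k (w x) *\<^sub>R w x = x"
    by (rule brouwer[OF assms(1,2) _ cont' maps])
  then show thesis
    using that[of x "k (w x)"] k(2)[of "w x"] dir[of x] nz[of x] by auto
qed

section \<open>Facet inequalities and the geometry at a vertex\<close>

text \<open>One outer normal \<open>a G\<close> and one offset \<open>b G\<close> are fixed for each
  facet, so that \<open>b G - a G \<bullet> x\<close> can serve as a coordinate. Membership is
  tested inside the affine hull because the polytope may have smaller dimension than the ambient
  space.\<close>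

locale polytope_inequalities =
  fixes P :: "'a::euclidean_space set" and a :: "'a set \<Rightarrow> 'a" and b :: "'a set \<Rightarrow> real"
  assumes polytope: "polytope P"
    and facet_le: "G facet_of P \<Longrightarrow> x \<in> P \<Longrightarrow> a G \<bullet> x \<le> b G"
    and facet_eq: "G facet_of P \<Longrightarrow> x \<in> P \<Longrightarrow> a G \<bullet> x = b G \<longleftrightarrow> x \<in> G"
    and mem_polytope: "y \<in> affine hull P \<Longrightarrow> (\<And>G. G facet_of P \<Longrightarrow> a G \<bullet> y \<le> b G) \<Longrightarrow> y \<in> P"

text \<open>Only \<open>mem_polytope\<close> needs an argument. If \<open>y\<close> were outside
  \<open>P\<close>, the segment from a relatively interior point \<open>z\<close> to
  \<open>y\<close> would leave \<open>P\<close> through some facet \<open>G\<close> before reaching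
  \<open>y\<close>. The inequality of \<open>G\<close> is strict at \<open>z\<close> and an equality
  at the exit point, so it would fail at \<open>y\<close>.\<close>

lemma polytope_facet_inequalities:
  fixes P :: "'a::euclidean_space set"
  assumes P: "polytope P"
  obtains a b where "polytope_inequalities P a b"
proof -
  have poly: "polyhedron P"
    using P by (rule polytope_imp_polyhedron)
  have "\<exists>a b. P \<subseteq> {x. a \<bullet> x \<le> b} \<and> G = P \<inter> {x. a \<bullet> x = b}" if "G facet_of P" for G
    using facet_of_polyhedron[OF poly that] by metis
  then obtain a b where ab: "\<And>G. G facet_of P \<Longrightarrow> P \<subseteq> {x. a G \<bullet> x \<le> b G}"
    "\<And>G. G facet_of P \<Longrightarrow> G = P \<inter> {x. a G \<bullet> x = b G}"
    by metis
  have le: "a G \<bullet> x \<le> b G" if "G facet_of P" "x \<in> P" for G x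
    using ab(1) that by blast
  have eq: "a G \<bullet> x = b G \<longleftrightarrow> x \<in> G" if "G facet_of P" "x \<in> P" for G x
    using ab(2)[OF that(1)] that(2) by blast
  show thesis
  proof (rule that, unfold_locales, rule P, erule (1) le, erule (1) eq)
    fix y assume y: "y \<in> affine hull P" and ineq: "\<And>G. G facet_of P \<Longrightarrow> a G \<bullet> y \<le> b G"
    show "y \<in> P"
    proof (rule ccontr)
      assume "y \<notin> P"
      have conv: "convex P" and bdd: "bounded P"
        using P by (simp_all add: polytope_imp_convex polytope_imp_bounded)
      have "P \<noteq> {}"
        using y by auto
      then obtain z where z: "z \<in> rel_interior P"
        using rel_interior_eq_empty[OF conv] by blast
      then have zP: "z \<in> P"
        using rel_interior_subset by blast
      have "z + (y - z) \<in> affine hull P" "y - z \<noteq> 0"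
        using y zP \<open>y \<notin> P\<close> by auto
      then obtain d where d: "0 < d" "z + d *\<^sub>R (y - z) \<in> rel_frontier P"
        using ray_to_rel_frontier[OF bdd z] by metis
      let ?x = "z + d *\<^sub>R (y - z)"
      obtain G where G: "G facet_of P" "?x \<in> G"
        using d(2) rel_frontier_of_polyhedron[OF poly] by auto
      have xP: "?x \<in> P"
        using G facet_of_imp_subset by blast
      have "d < 1"
      proof (rule ccontr)
        assume "\<not> d < 1"
        have "y = (1 - 1 / d) *\<^sub>R z + (1 / d) *\<^sub>R ?x"
          using d(1) by (simp add: algebra_simps)
        moreover have "(1 - 1 / d) *\<^sub>R z + (1 / d) *\<^sub>R ?x \<in> P"
          using \<open>\<not> d < 1\<close> d(1) by (intro convexD[OF conv zP xP]) auto
        ultimately show False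
          using \<open>y \<notin> P\<close> by simp
      qed
      have "a G \<bullet> z + d * (a G \<bullet> y - a G \<bullet> z) = b G"
        using eq[OF G(1) xP] G(2) by (simp add: inner_add_right inner_diff_right)
      moreover have "a G \<bullet> z < b G"
        using z G(1) le[OF G(1) zP] eq[OF G(1) zP] rel_interior_of_polyhedron[OF poly] by force
      moreover have "d * (a G \<bullet> y - a G \<bullet> z) \<le> d * (b G - a G \<bullet> z)"
        using d(1) ineq[OF G(1)] by (intro mult_left_mono) auto
      moreover have "d * (b G - a G \<bullet> z) < b G - a G \<bullet> z"
        using mult_strict_right_mono[OF \<open>d < 1\<close>, of "b G - a G \<bullet> z"] \<open>a G \<bullet> z < b G\<close> by simp
      ultimately show False by argo
    qed
  qed
qed

context polytope_inequalities begin

lemma facet_less: "G facet_of P \<Longrightarrow> x \<in> P \<Longrightarrow> x \<notin> G \<Longrightarrow> a G \<bullet> x < b G"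
  using facet_le facet_eq by fastforce

text \<open>Inequalities tight at \<open>v\<close> are preserved by the sign condition; the others
  are strict at \<open>v\<close> and survive a small step. Finiteness of the set of facets gives a
  common bound on the step.\<close>

lemma feasible_direction:
  assumes v: "v \<in> P" and u: "v + u \<in> affine hull P"
    and nonpos: "\<And>G. G facet_of P \<Longrightarrow> v \<in> G \<Longrightarrow> a G \<bullet> u \<le> 0"
  shows "\<forall>\<^sub>F t in at_right 0. v + t *\<^sub>R u \<in> P"
proof -
  have "\<forall>\<^sub>F t in at_right (0::real). a G \<bullet> (v + t *\<^sub>R u) \<le> b G" if G: "G facet_of P" for G
  proof (cases "v \<in> G")
    case True
    then have "a G \<bullet> v = b G" and "a G \<bullet> u \<le> 0"
      using G v facet_eq nonpos by auto
    then have "a G \<bullet> (v + t *\<^sub>R u) \<le> b G" if "0 < t" for t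
      using that by (simp add: inner_add_right mult_nonneg_nonpos)
    then show ?thesis
      using eventually_at_right_less[of "0::real"] by (auto elim: eventually_mono)
  next
    case False
    have "((\<lambda>t. a G \<bullet> (v + t *\<^sub>R u)) \<longlongrightarrow> a G \<bullet> (v + 0 *\<^sub>R u)) (at_right 0)"
      by (intro tendsto_intros)
    then have "\<forall>\<^sub>F t in at_right 0. a G \<bullet> (v + t *\<^sub>R u) < b G"
      using facet_less[OF G v False] by (intro order_tendstoD(2)) auto
    then show ?thesis
      by (rule eventually_mono) simp
  qed
  then have "\<forall>\<^sub>F t in at_right 0. \<forall>G\<in>{G. G facet_of P}. a G \<bullet> (v + t *\<^sub>R u) \<le> b G"
    using finite_polytope_facets[OF polytope] by (intro eventually_ball_finite) auto
  then show ?thesis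
  proof (rule eventually_mono)
    fix t assume "\<forall>G\<in>{G. G facet_of P}. a G \<bullet> (v + t *\<^sub>R u) \<le> b G"
    moreover have "v + t *\<^sub>R u \<in> affine hull P"
      using mem_affine[OF affine_affine_hull hull_inc[OF v] u, of "1 - t" t]
      by (simp add: algebra_simps)
    ultimately show "v + t *\<^sub>R u \<in> P"
      by (intro mem_polytope) auto
  qed
qed

text \<open>Otherwise both \<open>u\<close> and \<open>- u\<close> would be feasible directions, and
  \<open>v\<close> would be the midpoint of a nondegenerate segment in \<open>P\<close>.\<close>

lemma vertex_direction_eq_0:
  assumes v: "v extreme_point_of P" and u: "v + u \<in> affine hull P"
    and zero: "\<And>G. G facet_of P \<Longrightarrow> v \<in> G \<Longrightarrow> a G \<bullet> u = 0"
  shows "u = 0"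
proof (rule ccontr)
  assume "u \<noteq> 0"
  have vP: "v \<in> P"
    using v by (simp add: extreme_point_of_def)
  have "v + (- u) \<in> affine hull P"
    using mem_affine[OF affine_affine_hull hull_inc[OF vP] u, of 2 "-1"]
    by (simp add: algebra_simps scaleR_2)
  then have "\<forall>\<^sub>F t in at_right 0. v + t *\<^sub>R u \<in> P \<and> v + t *\<^sub>R (- u) \<in> P \<and> 0 < t"
    using feasible_direction[OF vP u] feasible_direction[OF vP, of "- u"] zero
      eventually_at_right_less[of "0::real"] by (auto intro!: eventually_conj)
  then obtain t where t: "v + t *\<^sub>R u \<in> P" "v + t *\<^sub>R (- u) \<in> P" "0 < t"
    using eventually_happens[of _ "at_right (0::real)"] by force
  have "v = (1 - 1/2) *\<^sub>R (v + t *\<^sub>R u) + (1/2) *\<^sub>R (v + t *\<^sub>R (- u))"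
    by (simp add: algebra_simps flip: scaleR_add_left)
  moreover have "v + t *\<^sub>R u \<noteq> v + t *\<^sub>R (- u)"
  proof
    assume "v + t *\<^sub>R u = v + t *\<^sub>R (- u)"
    then have "t *\<^sub>R u + t *\<^sub>R u = 0"
      by (simp add: eq_neg_iff_add_eq_0)
    then have "(2 * t) *\<^sub>R u = 0"
      by (metis mult_2 scaleR_add_left)
    then show False
      using \<open>u \<noteq> 0\<close> t(3) by simp
  qed
  ultimately have "v \<in> open_segment (v + t *\<^sub>R u) (v + t *\<^sub>R (- u))"
    unfolding in_segment by (intro conjI exI[of _ "1/2"]) auto
  then show False
    using v t by (auto simp: extreme_point_of_def)
qed

text \<open>These are the edge directions at a simple vertex, dual to the facet normals up to sign.
  The normals of all facets at \<open>v\<close> but \<open>F\<close> are too few to span, so they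
  annihilate some nonzero direction; the normal of \<open>F\<close> cannot annihilate it as well,
  and rescaling gives \<open>-1\<close>. The sign makes \<open>d F\<close> point into
  \<open>P\<close>.\<close>

lemma simple_vertex_dual_directions:
  assumes v: "v extreme_point_of P"
    and card: "int (card {F. F facet_of P \<and> v \<in> F}) = aff_dim P"
  obtains d where
    "\<And>F. F facet_of P \<Longrightarrow> v \<in> F \<Longrightarrow> v + d F \<in> affine hull P"
    "\<And>F G. F facet_of P \<Longrightarrow> v \<in> F \<Longrightarrow> G facet_of P \<Longrightarrow> v \<in> G \<Longrightarrow>
       a G \<bullet> d F = (if G = F then -1 else 0)"
proof -
  let ?FF = "{F. F facet_of P \<and> v \<in> F}"
  define D where "D = (\<lambda>x. x - v) ` (affine hull P)"
  have vP: "v \<in> P"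
    using v by (simp add: extreme_point_of_def)
  have sub: "subspace D"
    unfolding D_def by (rule affine_diffs_subspace_subtract[OF affine_affine_hull hull_inc[OF vP]])
  have dimD: "int (dim D) = aff_dim P"
    using aff_dim_dim_affine_diffs[OF affine_affine_hull hull_inc[OF vP]]
    by (simp add: D_def)
  have memD: "u \<in> D \<longleftrightarrow> v + u \<in> affine hull P" for u
    unfolding D_def by (force simp: image_iff)
  have fin: "finite ?FF"
    using finite_polytope_facets[OF polytope] by simp
  have "\<exists>u\<in>D. \<forall>G\<in>?FF. a G \<bullet> u = (if G = F then -1 else 0)" if F: "F \<in> ?FF" for F
  proof -
    have "card (a ` (?FF - {F})) \<le> card (?FF - {F})"
      using fin by (intro card_image_le) simp
    also have "\<dots> < card ?FF"
      using F fin by (intro psubset_card_mono) auto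
    also have "\<dots> = dim D"
      using card dimD by simp
    finally obtain u where u: "u \<in> D" "u \<noteq> 0" "\<And>c. c \<in> a ` (?FF - {F}) \<Longrightarrow> c \<bullet> u = 0"
      using exists_nonzero_orthogonal_in_subspace[OF sub, of "a ` (?FF - {F})"] fin by blast
    have nz: "a F \<bullet> u \<noteq> 0"
    proof
      assume "a F \<bullet> u = 0"
      then have "a G \<bullet> u = 0" if "G facet_of P" "v \<in> G" for G
        using u(3)[of "a G"] that by (cases "G = F") auto
      then show False
        using vertex_direction_eq_0[OF v] u memD by blast
    qed
    show ?thesis
    proof (intro bexI ballI)
      show "(- 1 / (a F \<bullet> u)) *\<^sub>R u \<in> D"
        using u(1) subspace_scale[OF sub] by blast
      fix G assume "G \<in> ?FF"
      then show "a G \<bullet> (- 1 / (a F \<bullet> u)) *\<^sub>R u = (if G = F then -1 else 0)"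
        using nz u(3)[of "a G"] by (cases "G = F") auto
    qed
  qed
  then have "\<forall>F\<in>?FF. \<exists>u. u \<in> D \<and> (\<forall>G\<in>?FF. a G \<bullet> u = (if G = F then -1 else 0))"
    by blast
  from bchoice[OF this] obtain d where d: "\<forall>F\<in>?FF. d F \<in> D \<and> (\<forall>G\<in>?FF. a G \<bullet> d F = (if G = F then -1 else 0))"
    by blast
  show thesis
    by (rule that[of d]) (use d memD in auto)
qed

text \<open>A nonempty \<open>F \<inter> G\<close> contains a vertex \<open>v\<close> of
  \<open>P\<close>. The dual directions of the other facets at \<open>v\<close> are independent and
  parallel to \<open>F \<inter> G\<close>, which bounds its dimension from below; being a proper
  face of \<open>F\<close> bounds it from above.\<close>

lemma meeting_facets_adjacent:
  assumes simple: "\<And>v. v extreme_point_of P \<Longrightarrow> int (card {F. F facet_of P \<and> v \<in> F}) = aff_dim P"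
    and F: "F facet_of P" and G: "G facet_of P" and ne: "F \<noteq> G" "F \<inter> G \<noteq> {}"
  shows "adjacent_facets P F G"
proof -
  have conv: "convex P" and comp: "compact P"
    using polytope by (simp_all add: polytope_imp_convex polytope_imp_compact)
  have faceF: "F face_of P" and faceG: "G face_of P"
    using F G by (simp_all add: facet_of_imp_face_of)
  have face: "F \<inter> G face_of P"
    using faceF faceG by (rule face_of_Int)
  have "compact (F \<inter> G)" "convex (F \<inter> G)"
    using face comp conv face_of_imp_compact face_of_imp_convex by blast+
  then obtain v where "v extreme_point_of (F \<inter> G)"
    using extreme_point_exists_convex ne(2) by blast
  then have v: "v extreme_point_of P" and vFG: "v \<in> F" "v \<in> G"
    using extreme_point_of_face[OF face] by auto
  have vP: "v \<in> P"
    using v by (simp add: extreme_point_of_def)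
  let ?FF = "{F. F facet_of P \<and> v \<in> F}"
  have fin: "finite ?FF"
    using finite_polytope_facets[OF polytope] by simp
  obtain d where d: "\<And>F. F facet_of P \<Longrightarrow> v \<in> F \<Longrightarrow> v + d F \<in> affine hull P"
    "\<And>F G. F facet_of P \<Longrightarrow> v \<in> F \<Longrightarrow> G facet_of P \<Longrightarrow> v \<in> G \<Longrightarrow>
       a G \<bullet> d F = (if G = F then -1 else 0)"
    by (rule simple_vertex_dual_directions[OF v simple[OF v]]) (rule that)
  have "\<forall>\<^sub>F t in at_right (0::real). \<forall>H\<in>?FF. v + t *\<^sub>R d H \<in> P"
    using fin feasible_direction[OF vP] d by (intro eventually_ball_finite ballI) auto
  then have "\<forall>\<^sub>F t in at_right (0::real). (\<forall>H\<in>?FF. v + t *\<^sub>R d H \<in> P) \<and> 0 < t"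
    using eventually_at_right_less[of "0::real"] by (rule eventually_conj)
  \<comment> \<open>A single positive step length serves all of the finitely many
    directions.\<close>
  then obtain t where t: "\<And>H. H \<in> ?FF \<Longrightarrow> v + t *\<^sub>R d H \<in> P" "0 < t"
    using eventually_happens[of _ "at_right (0::real)"] by force
  let ?K = "?FF - {F, G}"
  define W where "W = (\<lambda>x. x - v) ` (affine hull (F \<inter> G))"
  have vW: "v \<in> affine hull (F \<inter> G)"
    using vFG by (simp add: hull_inc)
  have dimW: "int (dim W) = aff_dim (F \<inter> G)"
    using aff_dim_dim_affine_diffs[OF affine_affine_hull vW] by (simp add: W_def)
  have subW: "subspace W"
    unfolding W_def by (rule affine_diffs_subspace_subtract[OF affine_affine_hull vW])
  have dW: "d H \<in> W" if H: "H \<in> ?K" for H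
  proof -
    have P: "v + t *\<^sub>R d H \<in> P"
      using t H by auto
    have "H \<noteq> F" "H \<noteq> G" "H facet_of P" "v \<in> H"
      using H by auto
    then have "a F \<bullet> d H = 0" "a G \<bullet> d H = 0"
      using d(2)[of H F] d(2)[of H G] F G vFG by auto
    then have "a F \<bullet> (v + t *\<^sub>R d H) = b F" "a G \<bullet> (v + t *\<^sub>R d H) = b G"
      using facet_eq[OF F vP] facet_eq[OF G vP] vFG by (simp_all add: inner_add_right)
    then have "v + t *\<^sub>R d H \<in> F \<inter> G"
      using facet_eq[OF F P] facet_eq[OF G P] by simp
    then have "t *\<^sub>R d H \<in> W"
      unfolding W_def by (intro image_eqI[of _ _ "v + t *\<^sub>R d H"]) (auto simp: hull_inc)
    then have "(1 / t) *\<^sub>R (t *\<^sub>R d H) \<in> W"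
      by (rule subspace_scale[OF subW])
    then show ?thesis
      using t(2) by simp
  qed
  have inj: "inj_on d ?K"
  proof (rule inj_onI)
    fix H H' assume "H \<in> ?K" "H' \<in> ?K" "d H = d H'"
    then show "H = H'"
      using d(2)[of H H] d(2)[of H' H] by (auto split: if_splits)
  qed
  have "independent (d ` ?K)"
  proof (rule independent_if_scalars_zero)
    show "finite (d ` ?K)"
      using fin by simp
    fix f x assume sum0: "(\<Sum>y\<in>d ` ?K. f y *\<^sub>R y) = 0" and x: "x \<in> d ` ?K"
    obtain H where H: "H \<in> ?K" "x = d H"
      using x by auto
    \<comment> \<open>By duality, pairing with \<open>a H\<close> isolates the coefficient of
      \<open>d H\<close>.\<close>
    have "0 = a H \<bullet> (\<Sum>E\<in>?K. f (d E) *\<^sub>R d E)"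
      using sum0 by (simp add: sum.reindex[OF inj])
    also have "\<dots> = (\<Sum>E\<in>?K. f (d E) * (a H \<bullet> d E))"
      by (simp add: inner_sum_right)
    also have "\<dots> = (\<Sum>E\<in>?K. if E = H then - f (d E) else 0)"
      using H(1) d(2) by (intro sum.cong) auto
    also have "\<dots> = - f x"
      using fin H by (simp add: sum.delta)
    finally show "f x = 0" by simp
  qed
  then have "card (d ` ?K) \<le> dim W"
    using dW by (intro independent_card_le_dim) auto
  then have "card ?K \<le> dim W"
    using card_image[OF inj] by simp
  moreover have "int (card ?K) = aff_dim P - 2"
  proof -
    \<comment> \<open>This bound makes the natural-number subtraction in the cardinality of the
      difference exact.\<close>
    have "card {F, G} \<le> card ?FF"
      using F G vFG fin by (intro card_mono) auto
    then show ?thesis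
      using F G vFG ne(1) fin simple[OF v] by (subst card_Diff_subset) auto
  qed
  ultimately have ge: "aff_dim P - 2 \<le> aff_dim (F \<inter> G)"
    using dimW by simp
  have "F \<inter> G \<noteq> F"
  proof
    assume "F \<inter> G = F"
    then have "F face_of G"
      using face_of_face[OF faceG, of F] faceF by auto
    then have "aff_dim F < aff_dim G"
      using ne(1) face_of_aff_dim_lt face_of_imp_convex[OF faceG] by blast
    then show False
      using F G by (simp add: facet_of_def)
  qed
  moreover have "F \<inter> G face_of F"
    using face by (meson face_of_subset faceF face_of_imp_subset inf_le1)
  ultimately have "aff_dim (F \<inter> G) < aff_dim F"
    using face_of_aff_dim_lt face_of_imp_convex[OF faceF] by blast
  then have "aff_dim (F \<inter> G) = aff_dim P - 2"
    using ge F by (simp add: facet_of_def)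
  then show ?thesis
    using F G ne face by (simp add: adjacent_facets_def)
qed

end

section \<open>Thickening a finite closed family\<close>

text \<open>The minimum over a nonempty \<open>K\<close> is attained and positive. The
  \<open>eventually\<close> form lets finitely many smallness conditions be combined later.\<close>

lemma eventually_below_on_compact:
  fixes f :: "'a::topological_space \<Rightarrow> real"
  assumes "compact K" "continuous_on K f" "\<And>x. x \<in> K \<Longrightarrow> 0 < f x"
  shows "\<forall>\<^sub>F m in at_right 0. \<forall>x\<in>K. m < f x"
proof (cases "K = {}")
  case False
  then obtain y where y: "y \<in> K" "\<And>x. x \<in> K \<Longrightarrow> f y \<le> f x"
    using continuous_attains_inf[OF assms(1) False assms(2)] by blast
  have "((\<lambda>m. m) \<longlongrightarrow> 0) (at_right (0::real))"
    by (rule tendsto_ident_at)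
  then have "\<forall>\<^sub>F m in at_right 0. m < f y"
    using assms(3)[OF y(1)] by (intro order_tendstoD(2))
  then show ?thesis
    by (rule eventually_mono) (use y(2) in force)
qed simp

text \<open>The sum of the distances is continuous and positive on \<open>K\<close>, so it is
  bounded below there; hence the distances cannot all be small at once.\<close>

lemma eventually_away_from_disjoint_family:
  fixes Y :: "'i \<Rightarrow> 'a::euclidean_space set"
  assumes "compact K" "finite J" "\<And>j. j \<in> J \<Longrightarrow> closed (Y j) \<and> Y j \<noteq> {}"
    and "K \<inter> (\<Inter>j\<in>J. Y j) = {}"
  shows "\<forall>\<^sub>F \<delta> in at_right 0. \<forall>x\<in>K. \<exists>j\<in>J. \<delta> \<le> infdist x (Y j)"
proof -
  \<comment> \<open>The summand \<open>1\<close> keeps the denominator positive for empty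
    \<open>J\<close> and makes the final comparison strict.\<close>
  have pos: "0 < (\<Sum>j\<in>J. infdist x (Y j)) / (real (card J) + 1)" if x: "x \<in> K" for x
  proof -
    obtain j where j: "j \<in> J" "x \<notin> Y j"
      using assms(4) x by blast
    then have "infdist x (Y j) \<noteq> 0"
      using assms(3)[OF j(1)] in_closed_iff_infdist_zero by blast
    then have "0 < infdist x (Y j)"
      by (simp add: order_less_le infdist_nonneg)
    then have "0 < (\<Sum>j\<in>J. infdist x (Y j))"
      using j(1) assms(2) by (intro sum_pos2) (auto simp: infdist_nonneg)
    then show ?thesis by simp
  qed
  have "\<forall>\<^sub>F \<delta> in at_right 0. \<forall>x\<in>K. \<delta> < (\<Sum>j\<in>J. infdist x (Y j)) / (real (card J) + 1)"
    using assms(1) pos by (intro eventually_below_on_compact continuous_intros) auto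
  then show ?thesis
    using eventually_at_right_less[of "0::real"]
  proof eventually_elim
    fix \<delta> :: real
    assume \<delta>: "\<forall>x\<in>K. \<delta> < (\<Sum>j\<in>J. infdist x (Y j)) / (real (card J) + 1)" "0 < \<delta>"
    show "\<forall>x\<in>K. \<exists>j\<in>J. \<delta> \<le> infdist x (Y j)"
    proof (rule ccontr)
      assume "\<not> ?thesis"
      then obtain x where x: "x \<in> K" "\<And>j. j \<in> J \<Longrightarrow> infdist x (Y j) \<le> \<delta>"
        by force
      then have "(\<Sum>j\<in>J. infdist x (Y j)) \<le> real (card J) * \<delta>"
        using sum_bounded_above[of J "\<lambda>j. infdist x (Y j)" \<delta>] by simp
      moreover have "\<delta> * (real (card J) + 1) < (\<Sum>j\<in>J. infdist x (Y j))"
        using \<delta>(1) x(1) by (simp add: pos_less_divide_eq)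
      ultimately show False
        using \<delta>(2) by (simp add: algebra_simps)
    qed
  qed
qed

text \<open>The previous lemma is applied to every subfamily without a common point in
  \<open>P\<close> and to every disjoint pair of a \<open>Y j\<close> and a member of
  \<open>\<F>\<close>. These are finitely many conditions, so one \<open>\<delta>\<close> creates
  neither a new overlap nor a new contact.\<close>

lemma thickening_keeps_intersection_pattern:
  fixes Y :: "'i \<Rightarrow> 'a::euclidean_space set"
  assumes "compact P" and J: "finite J" and Y: "\<And>j. j \<in> J \<Longrightarrow> closed (Y j) \<and> Y j \<noteq> {}"
    and \<F>: "finite \<F>" "\<And>F. F \<in> \<F> \<Longrightarrow> compact F"
  obtains \<delta> :: real where "0 < \<delta>"
    "\<And>x. x \<in> P \<Longrightarrow> \<exists>z\<in>P. \<forall>j\<in>J. infdist x (Y j) < \<delta> \<longrightarrow> z \<in> Y j"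
    "\<And>x F j. F \<in> \<F> \<Longrightarrow> x \<in> F \<Longrightarrow> j \<in> J \<Longrightarrow> infdist x (Y j) < \<delta> \<Longrightarrow> Y j \<inter> F \<noteq> {}"
proof -
  have "\<forall>\<^sub>F \<delta> in at_right 0. \<forall>J'\<in>{J'\<in>Pow J. P \<inter> (\<Inter>j\<in>J'. Y j) = {}}.
      \<forall>x\<in>P. \<exists>j\<in>J'. \<delta> \<le> infdist x (Y j)"
    using assms by (intro eventually_ball_finite ballI eventually_away_from_disjoint_family)
      (auto intro: finite_subset)
  moreover have "\<forall>\<^sub>F \<delta> in at_right 0. \<forall>(F, j)\<in>{(F, j)\<in>\<F> \<times> J. Y j \<inter> F = {}}.
      \<forall>x\<in>F. \<exists>i\<in>{j}. \<delta> \<le> infdist x (Y i)"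
  proof (intro eventually_ball_finite ballI)
    show "finite {(F, j)\<in>\<F> \<times> J. Y j \<inter> F = {}}"
      using J \<F> by (intro finite_subset[OF _ finite_cartesian_product[OF \<F>(1) J]]) auto
    fix p assume p: "p \<in> {(F, j)\<in>\<F> \<times> J. Y j \<inter> F = {}}"
    obtain F j where "p = (F, j)"
      by (cases p)
    then show "\<forall>\<^sub>F \<delta> in at_right 0. case p of (F, j) \<Rightarrow> \<forall>x\<in>F. \<exists>i\<in>{j}. \<delta> \<le> infdist x (Y i)"
      using p \<F>(2) Y eventually_away_from_disjoint_family[of F "{j}" Y] by auto
  qed
  ultimately have "\<forall>\<^sub>F \<delta> in at_right (0::real).
      (\<forall>J'\<in>{J'\<in>Pow J. P \<inter> (\<Inter>j\<in>J'. Y j) = {}}. \<forall>x\<in>P. \<exists>j\<in>J'. \<delta> \<le> infdist x (Y j)) \<and>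
      (\<forall>(F, j)\<in>{(F, j)\<in>\<F> \<times> J. Y j \<inter> F = {}}. \<forall>x\<in>F. \<exists>i\<in>{j}. \<delta> \<le> infdist x (Y i)) \<and> 0 < \<delta>"
    using eventually_at_right_less[of "0::real"] by (intro eventually_conj)
  then obtain \<delta> :: real where \<delta>: "0 < \<delta>"
    "\<And>J' x. J' \<subseteq> J \<Longrightarrow> P \<inter> (\<Inter>j\<in>J'. Y j) = {} \<Longrightarrow> x \<in> P \<Longrightarrow> \<exists>j\<in>J'. \<delta> \<le> infdist x (Y j)"
    "\<And>F j x. F \<in> \<F> \<Longrightarrow> j \<in> J \<Longrightarrow> Y j \<inter> F = {} \<Longrightarrow> x \<in> F \<Longrightarrow> \<delta> \<le> infdist x (Y j)"
    using eventually_happens[of _ "at_right (0::real)"] by force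
  show thesis
  proof (rule that[OF \<delta>(1)])
    fix x assume "x \<in> P"
    then have "P \<inter> (\<Inter>j\<in>{j\<in>J. infdist x (Y j) < \<delta>}. Y j) \<noteq> {}"
      using \<delta>(2)[of "{j\<in>J. infdist x (Y j) < \<delta>}" x] by force
    then show "\<exists>z\<in>P. \<forall>j\<in>J. infdist x (Y j) < \<delta> \<longrightarrow> z \<in> Y j"
      by blast
  next
    fix x F j assume "F \<in> \<F>" "x \<in> F" "j \<in> J" "infdist x (Y j) < \<delta>"
    then show "Y j \<inter> F \<noteq> {}"
      using \<delta>(3)[of F j x] by force
  qed
qed

section \<open>A point in general position\<close>

text \<open>At most \<open>n\<close> points span an affine subspace of dimension below
  \<open>n\<close>, whose complement in \<open>H\<close> is relatively open and dense. By Baire's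
  theorem the finitely many complements have a dense intersection.\<close>

lemma exists_point_off_small_affine_hulls:
  fixes H :: "'a::euclidean_space set"
  assumes H: "affine H" "aff_dim H = int n" and J: "finite J" and U: "open U" "U \<inter> H \<noteq> {}"
  obtains q where "q \<in> U" "q \<in> H" "\<And>I. I \<subseteq> J \<Longrightarrow> card I \<le> n \<Longrightarrow> q \<notin> affine hull (e ` I)"
proof -
  let ?\<G> = "(\<lambda>I. H - affine hull (e ` I)) ` {I \<in> Pow J. card I \<le> n}"
  have "H \<subseteq> closure (\<Inter>?\<G>)"
  proof (rule Baire)
    show "closed H"
      using H(1) by (rule affine_closed)
    show "countable ?\<G>"
      using J by (intro countable_image countable_finite) simp
    fix T assume "T \<in> ?\<G>"
    then obtain I where I: "I \<subseteq> J" "card I \<le> n" and T: "T = H - affine hull (e ` I)"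
      by auto
    have "finite I"
      using I(1) J by (rule finite_subset)
    then have "aff_dim (affine hull (e ` I)) < aff_dim H"
      using aff_dim_le_card[of "e ` I"] card_image_le[of I e] I(2) H(2) by simp
    then have "closure T = H"
      unfolding T using H(1) by (rule dense_complement_affine)
    moreover have "openin (top_of_set H) T"
      unfolding T by (metis Diff_eq closed_affine_hull open_Compl openin_open_Int)
    ultimately show "openin (top_of_set H) T \<and> H \<subseteq> closure T"
      by simp
  qed
  then obtain q where "q \<in> \<Inter>?\<G>" "q \<in> U"
    using U open_Int_closure_eq_empty[OF U(1), of "\<Inter>?\<G>"] by blast
  \<comment> \<open>The empty index set contributes \<open>H\<close> itself to the family, so a
    point of the intersection lies in \<open>H\<close>.\<close>
  moreover have "{} \<in> {I \<in> Pow J. card I \<le> n}"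
    by simp
  ultimately show thesis
    using that[of q] by blast
qed

section \<open>Clopen partitions of a compact set\<close>

text \<open>From each new set the union of the earlier ones is removed; that union is open, so the
  remainder is still closed.\<close>

lemma finite_clopen_cover_disjointify:
  assumes "finite \<C>" "\<And>K. K \<in> \<C> \<Longrightarrow> openin T K \<and> closedin T K"
  shows "\<exists>\<D>. finite \<D> \<and> pairwise disjnt \<D> \<and> \<Union>\<D> = \<Union>\<C> \<and>
    (\<forall>D\<in>\<D>. closedin T D \<and> (\<exists>K\<in>\<C>. D \<subseteq> K))"
  using assms
proof (induction \<C> rule: finite_induct)
  case empty
  then show ?case
    by (intro exI[of _ "{}"]) auto
next
  case (insert K \<C>)
  then obtain \<D> where \<D>: "finite \<D>" "pairwise disjnt \<D>" "\<Union>\<D> = \<Union>\<C>"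
    "\<forall>D\<in>\<D>. closedin T D \<and> (\<exists>K\<in>\<C>. D \<subseteq> K)"
    by auto
  have "closedin T (K - \<Union>\<C>)"
    using insert.prems by (intro closedin_diff) auto
  moreover have "pairwise disjnt (insert (K - \<Union>\<C>) \<D>)"
    unfolding pairwise_insert using \<D>(2,3) by (auto simp: disjnt_def)
  ultimately show ?case
    using \<D> by (intro exI[of _ "insert (K - \<Union>\<C>) \<D>"]) auto
qed

text \<open>
  In a compact set every component is the intersection of its clopen neighbourhoods (Sura-Bura),
  so it can be separated by a clopen set from the finitely many members of \<open>\<F>\<close> that it misses.
\<close>

lemma compact_finite_clopen_partition:
  fixes X :: "'a::euclidean_space set"
  assumes X: "compact X" and \<F>: "finite \<F>" "\<And>F. F \<in> \<F> \<Longrightarrow> closed F"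
  obtains \<D> where "finite \<D>" "pairwise disjnt \<D>" "\<Union>\<D> = X"
    "\<And>D. D \<in> \<D> \<Longrightarrow> closed D \<and> (\<exists>C\<in>components X. \<forall>F\<in>\<F>. D \<inter> F \<noteq> {} \<longrightarrow> C \<inter> F \<noteq> {})"
proof -
  have "\<exists>K. openin (top_of_set X) K \<and> compact K \<and> C \<subseteq> K \<and> (\<forall>F\<in>\<F>. K \<inter> F \<noteq> {} \<longrightarrow> C \<inter> F \<noteq> {})"
    if C: "C \<in> components X" for C
  proof -
    let ?U = "- \<Union>{F\<in>\<F>. C \<inter> F = {}}"
    have C': "compact C"
      using X C by (rule compact_components)
    have U: "open ?U" "C \<subseteq> ?U"
      using \<F> by (auto intro!: open_Compl closed_Union)
    obtain K where "openin (top_of_set X) K" "compact K" "C \<subseteq> K" "K \<subseteq> ?U"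
      by (rule Sura_Bura_clopen_subset[OF closed_imp_locally_compact[OF compact_imp_closed[OF X]] C C' U])
        (rule that)
    then show ?thesis
      by blast
  qed
  then obtain k where k: "\<And>C. C \<in> components X \<Longrightarrow> openin (top_of_set X) (k C) \<and> compact (k C) \<and>
      C \<subseteq> k C \<and> (\<forall>F\<in>\<F>. k C \<inter> F \<noteq> {} \<longrightarrow> C \<inter> F \<noteq> {})"
    by metis
  have "X \<subseteq> \<Union>(k ` components X)"
  proof
    fix x assume "x \<in> X"
    then obtain C where "C \<in> components X" "x \<in> C"
      using Union_components[of X] by (metis UnionE)
    then show "x \<in> \<Union>(k ` components X)"
      using k[of C] by auto
  qed
  moreover have "\<forall>K\<in>k ` components X. openin (top_of_set X) K"
    using k by blast
  \<comment> \<open>There may be infinitely many components, but compactness leaves finitely many of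
    their clopen neighbourhoods.\<close>
  ultimately obtain \<C> where \<C>: "\<C> \<subseteq> k ` components X" "finite \<C>" "X \<subseteq> \<Union>\<C>"
    using X unfolding compact_eq_openin_cover by meson
  have clopen: "openin (top_of_set X) K \<and> closedin (top_of_set X) K" if K: "K \<in> \<C>" for K
  proof -
    obtain C where "C \<in> components X" "K = k C"
      using \<C>(1) K by blast
    then have K': "openin (top_of_set X) K" "compact K"
      using k[of C] by simp_all
    then have "closedin (top_of_set X) K"
      by (intro closed_subset compact_imp_closed openin_imp_subset)
    with K' show ?thesis
      by simp
  qed
  obtain \<D> where \<D>: "finite \<D>" "pairwise disjnt \<D>" "\<Union>\<D> = \<Union>\<C>"
    "\<forall>D\<in>\<D>. closedin (top_of_set X) D \<and> (\<exists>K\<in>\<C>. D \<subseteq> K)"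
    using finite_clopen_cover_disjointify[OF \<C>(2) clopen] by blast
  have "\<Union>\<C> \<subseteq> X"
    using clopen openin_imp_subset by blast
  show thesis
  proof (rule that[OF \<D>(1,2)])
    show "\<Union>\<D> = X"
      using \<D>(3) \<C>(3) \<open>\<Union>\<C> \<subseteq> X\<close> by simp
    fix D assume D: "D \<in> \<D>"
    have "closed D"
      using \<D>(4) D closedin_closed_trans compact_imp_closed[OF X] by blast
    obtain K where K: "K \<in> \<C>" "D \<subseteq> K"
      using \<D>(4) D by blast
    obtain C where C: "C \<in> components X" "K = k C"
      using \<C>(1) K(1) by blast
    have "C \<inter> F \<noteq> {}" if "F \<in> \<F>" "D \<inter> F \<noteq> {}" for F
    proof -
      have "k C \<inter> F \<noteq> {}"
        using that(2) K(2) C(2) by auto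
      then show ?thesis
        using k[OF C(1)] that(1) by simp
    qed
    then show "closed D \<and> (\<exists>C\<in>components X. \<forall>F\<in>\<F>. D \<inter> F \<noteq> {} \<longrightarrow> C \<inter> F \<noteq> {})"
      using C(1) \<open>closed D\<close> by auto
  qed
qed

section \<open>Closed covers of a colored simple polytope\<close>

context polytope_inequalities begin

lemma add_sum_directions:
  assumes "v \<in> P" "\<And>i. i \<in> I \<Longrightarrow> v + u i \<in> affine hull P"
  shows "v + (\<Sum>i\<in>I. c i *\<^sub>R u i) \<in> affine hull P"
proof -
  define D where "D = (\<lambda>x. x - v) ` (affine hull P)"
  have sub: "subspace D"
    unfolding D_def
    by (rule affine_diffs_subspace_subtract[OF affine_affine_hull hull_inc[OF assms(1)]])
  have "u i \<in> D" if "i \<in> I" for i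
    unfolding D_def using assms(2)[OF that] by (intro image_eqI[of _ _ "v + u i"]) auto
  then have "(\<Sum>i\<in>I. c i *\<^sub>R u i) \<in> D"
    using sub by (intro subspace_sum subspace_scale) auto
  then show ?thesis
    by (auto simp: D_def)
qed

text \<open>This version speaks of whole sets instead of components and will be applied to the
  clopen pieces. In the negated case the multiplicity bound makes a field \<open>w\<close>
  nonvanishing, while the coloring excludes the frontier point that such a field must have.\<close>

lemma cover_member_meets_same_color_facets:
  fixes Y :: "'i \<Rightarrow> 'a set"
  assumes dim: "aff_dim P = int n"
    and simple: "\<And>v. v extreme_point_of P \<Longrightarrow> card {F. F facet_of P \<and> v \<in> F} = n"
    and coloring: "proper_coloring P n h"
    and J: "finite J" and Y: "\<And>j. j \<in> J \<Longrightarrow> closed (Y j) \<and> Y j \<noteq> {}"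
    and cover: "P \<subseteq> (\<Union>j\<in>J. Y j)"
    and mult: "\<And>x. x \<in> P \<Longrightarrow> card {j \<in> J. x \<in> Y j} \<le> n"
  shows "\<exists>j\<in>J. \<exists>F G. F facet_of P \<and> G facet_of P \<and> F \<noteq> G \<and> h F = h G \<and>
    Y j \<inter> F \<noteq> {} \<and> Y j \<inter> G \<noteq> {}"
proof (rule ccontr)
  assume neg: "\<not> ?thesis"
  have no_two: "Y j \<inter> F = {}"
    if "j \<in> J" "F facet_of P" "G facet_of P" "F \<noteq> G" "h F = h G" "Y j \<inter> G \<noteq> {}" for j F G
    using neg that by blast
  have conv: "convex P" and comp: "compact P" and poly: "polyhedron P"
    using polytope
    by (simp_all add: polytope_imp_convex polytope_imp_compact polytope_imp_polyhedron)
  have "P \<noteq> {}"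
    using dim by auto
  then obtain v where v: "v extreme_point_of P"
    using extreme_point_exists_convex[OF comp conv] by blast
  then have vP: "v \<in> P"
    by (simp add: extreme_point_of_def)
  define \<F> where "\<F> = {F. F facet_of P}"
  define V where "V = {F. F facet_of P \<and> v \<in> F}"
  have finF: "finite \<F>" and finV: "finite V"
    using finite_polytope_facets[OF polytope] by (simp_all add: \<F>_def V_def)
  have compF: "compact F" if "F \<in> \<F>" for F
    using that comp conv face_of_imp_compact facet_of_imp_face_of by (auto simp: \<F>_def)
  have VF: "F facet_of P" "v \<in> F" if "F \<in> V" for F
    using that by (auto simp: V_def)
  have same_color_disjoint: "F \<inter> G = {}"
    if "F facet_of P" "G facet_of P" "F \<noteq> G" "h F = h G" for F G
  proof (rule ccontr)
    assume "F \<inter> G \<noteq> {}"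
    with that have "adjacent_facets P F G"
      using simple dim by (intro meeting_facets_adjacent) simp_all
    then show False
      using coloring that(4) by (simp add: proper_coloring_def)
  qed
  \<comment> \<open>Facets through \<open>v\<close> meet, so their colors differ; as there are
    \<open>n\<close> of them, every color occurs at \<open>v\<close>.\<close>
  have "inj_on h V"
    using same_color_disjoint VF by (intro inj_onI) blast
  moreover have "h ` V \<subseteq> {1..n}"
    using coloring VF(1) by (auto simp: proper_coloring_def)
  ultimately have "h ` V = {1..n}"
    using simple[OF v] by (intro card_subset_eq) (auto simp: card_image V_def)
  then have color_at_v: "\<exists>F\<in>V. h F = h G" if "G facet_of P" for G
  proof -
    have "h G \<in> h ` V"
      using coloring that \<open>h ` V = {1..n}\<close> by (auto simp: proper_coloring_def)
    then show ?thesis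
      by (metis imageE)
  qed
  have "int (card {F. F facet_of P \<and> v \<in> F}) = aff_dim P"
    using simple[OF v] dim by simp
  then obtain d where "\<And>F. F facet_of P \<Longrightarrow> v \<in> F \<Longrightarrow> v + d F \<in> affine hull P"
    "\<And>F G. F facet_of P \<Longrightarrow> v \<in> F \<Longrightarrow> G facet_of P \<Longrightarrow> v \<in> G \<Longrightarrow>
       a G \<bullet> d F = (if G = F then -1 else 0)"
    by (rule simple_vertex_dual_directions[OF v]) (rule that)
  then have d: "\<And>F. F \<in> V \<Longrightarrow> v + d F \<in> affine hull P"
    "\<And>F G. F \<in> V \<Longrightarrow> G \<in> V \<Longrightarrow> a G \<bullet> d F = (if G = F then -1 else 0)"
    by (auto simp: V_def)
  \<comment> \<open>The slacks of the facets at \<open>v\<close> are affine coordinates on the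
    affine hull with origin \<open>v\<close>, and the \<open>d F\<close> are the unit
    vectors.\<close>
  define slack where "slack F x = b F - a F \<bullet> x" for F x
  have slack_comb: "slack F (v + (\<Sum>G\<in>V. c G *\<^sub>R d G)) = c F" if F: "F \<in> V" for F c
  proof -
    have "a F \<bullet> (\<Sum>G\<in>V. c G *\<^sub>R d G) = (\<Sum>G\<in>V. if G = F then - c G else 0)"
      using d(2) F by (auto simp: inner_sum_right intro!: sum.cong)
    also have "\<dots> = - c F"
      using F finV by simp
    finally show ?thesis
      using facet_eq[OF VF(1)[OF F] vP] VF(2)[OF F] by (simp add: slack_def inner_add_right)
  qed
  have comb_mem: "v + (\<Sum>G\<in>V. c G *\<^sub>R d G) \<in> affine hull P" for c
    using vP d(1) by (rule add_sum_directions)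
  \<comment> \<open>With coordinates \<open>0\<close> and \<open>1\<close>, each coordinate of
    \<open>e j\<close> is strictly on a known side of that of any point in the open unit
    cube.\<close>
  define e where "e j = v + (\<Sum>F\<in>V. (if Y j \<inter> F = {} then 1 else 0) *\<^sub>R d F)" for j
  have slack_e: "slack F (e j) = (if Y j \<inter> F = {} then 1 else 0)" if "F \<in> V" for F j
    unfolding e_def by (rule slack_comb[OF that])
  have e_mem: "e j \<in> affine hull P" for j
    unfolding e_def by (rule comb_mem)
  have cont_slack: "continuous_on UNIV (slack F)" for F
    unfolding slack_def by (intro continuous_intros)
  \<comment> \<open>This is the open unit cube in the slack coordinates at \<open>v\<close>; its
    centre, with all coordinates \<open>1/2\<close>, shows that it meets the affine hull.\<close>
  let ?U = "\<Inter>F\<in>V. {x. 0 < slack F x} \<inter> {x. slack F x < 1}"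
  have "open ?U"
    using finV cont_slack by (intro open_INT open_Int ballI open_Collect_less continuous_on_const) auto
  moreover have "v + (\<Sum>F\<in>V. (1/2) *\<^sub>R d F) \<in> ?U \<inter> affine hull P"
  proof -
    define y where "y = v + (\<Sum>F\<in>V. (1/2) *\<^sub>R d F)"
    have "0 < slack F y \<and> slack F y < 1" if "F \<in> V" for F
      unfolding y_def by (subst (1 2) slack_comb[OF that]) simp
    moreover have "y \<in> affine hull P"
      unfolding y_def by (rule comb_mem)
    ultimately have "y \<in> ?U \<inter> affine hull P"
      by auto
    then show ?thesis
      by (simp only: y_def)
  qed
  ultimately have U: "open ?U" "?U \<inter> affine hull P \<noteq> {}"
    by auto
  have "aff_dim (affine hull P) = int n"
    using dim by simp
  then obtain q where qU: "q \<in> ?U" and q_mem: "q \<in> affine hull P"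
      and q_off: "\<And>I. I \<subseteq> J \<Longrightarrow> card I \<le> n \<Longrightarrow> q \<notin> affine hull (e ` I)"
    by (rule exists_point_off_small_affine_hulls[OF affine_affine_hull _ J U]) (rule that)
  have slack_q: "0 < slack F q \<and> slack F q < 1" if "F \<in> V" for F
    using qU that by auto
  have "\<forall>\<^sub>F m in at_right 0. \<forall>(F, G)\<in>{(F, G)\<in>V \<times> \<F>. F \<noteq> G \<and> h F = h G}. \<forall>x\<in>G. m < slack F x"
  proof (intro eventually_ball_finite ballI)
    show "finite {(F, G)\<in>V \<times> \<F>. F \<noteq> G \<and> h F = h G}"
      by (intro finite_subset[OF _ finite_cartesian_product[OF finV finF]]) auto
    fix p assume p: "p \<in> {(F, G)\<in>V \<times> \<F>. F \<noteq> G \<and> h F = h G}"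
    obtain F G where FG: "p = (F, G)"
      by (cases p)
    have "0 < slack F x" if "x \<in> G" for x
      using facet_less[of F x] p that same_color_disjoint[of F G] VF(1)[of F] facet_of_imp_subset[of G P]
      by (auto simp: FG slack_def \<F>_def)
    then have "\<forall>\<^sub>F m in at_right 0. \<forall>x\<in>G. m < slack F x"
      using p compF continuous_on_subset[OF cont_slack]
      by (intro eventually_below_on_compact) (auto simp: FG)
    then show "\<forall>\<^sub>F m in at_right 0. case p of (F, G) \<Rightarrow> \<forall>x\<in>G. m < slack F x"
      by (simp add: FG)
  qed
  then have "\<forall>\<^sub>F m in at_right (0::real).
      (\<forall>(F, G)\<in>{(F, G)\<in>V \<times> \<F>. F \<noteq> G \<and> h F = h G}. \<forall>x\<in>G. m < slack F x) \<and> 0 < m"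
    using eventually_at_right_less[of "0::real"] by (rule eventually_conj)
  \<comment> \<open>Other facets of the color of \<open>F\<close> are compact and disjoint from
    \<open>F\<close>, so the slack of \<open>F\<close> has a positive lower bound on them.\<close>
  then obtain m :: real where m: "0 < m"
    "\<And>F G x. F \<in> V \<Longrightarrow> G facet_of P \<Longrightarrow> F \<noteq> G \<Longrightarrow> h F = h G \<Longrightarrow> x \<in> G \<Longrightarrow> m < slack F x"
    using eventually_happens[of _ "at_right (0::real)"] by (force simp: \<F>_def)
  have "open (\<Inter>F\<in>V. {x. slack F x < m})"
    using finV cont_slack by (intro open_INT ballI open_Collect_less continuous_on_const) auto
  moreover have "v \<in> (\<Inter>F\<in>V. {x. slack F x < m})"
    using slack_comb[of _ "\<lambda>_. 0"] m(1) by simp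
  moreover have "v \<in> closure (rel_interior P)"
    using vP closure_subset[of P] convex_closure_rel_interior[OF conv] by blast
  \<comment> \<open>All slacks of facets at \<open>v\<close> vanish at \<open>v\<close>, so they are
    below \<open>m\<close> at relatively interior points close to \<open>v\<close>.\<close>
  ultimately obtain x0 where x0: "x0 \<in> rel_interior P" "\<And>F. F \<in> V \<Longrightarrow> slack F x0 < m"
    using open_Int_closure_eq_empty[of "\<Inter>F\<in>V. {x. slack F x < m}" "rel_interior P"] by blast
  have x0P: "x0 \<in> P"
    using x0(1) rel_interior_subset by blast
  have x0_pos: "0 < slack F x0" if "F facet_of P" for F
    using facet_less[OF that x0P] x0(1) that rel_interior_of_polyhedron[OF poly]
    by (auto simp: slack_def)
  obtain \<delta> :: real where \<delta>: "0 < \<delta>"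
    "\<And>x. x \<in> P \<Longrightarrow> \<exists>z\<in>P. \<forall>j\<in>J. infdist x (Y j) < \<delta> \<longrightarrow> z \<in> Y j"
    "\<And>x F j. F \<in> \<F> \<Longrightarrow> x \<in> F \<Longrightarrow> j \<in> J \<Longrightarrow> infdist x (Y j) < \<delta> \<Longrightarrow> Y j \<inter> F \<noteq> {}"
    by (rule thickening_keeps_intersection_pattern[OF comp J Y finF compF]) (assumption | rule that)+
  \<comment> \<open>These bump functions are positive exactly on the open
    \<open>\<delta>\<close>-neighbourhoods of the pieces.\<close>
  define \<psi> where "\<psi> j x = max 0 (\<delta> - infdist x (Y j))" for j x
  have \<psi>_nonneg: "0 \<le> \<psi> j x" for j x
    by (simp add: \<psi>_def)
  have \<psi>_pos: "0 < \<psi> j x \<longleftrightarrow> infdist x (Y j) < \<delta>" for j x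
    by (auto simp: \<psi>_def)
  have \<psi>_sum: "\<exists>j\<in>J. 0 < \<psi> j x" if x: "x \<in> P" for x
  proof -
    obtain j where "j \<in> J" "x \<in> Y j"
      using cover x by blast
    then show ?thesis
      using \<delta>(1) \<psi>_pos by (intro bexI[of _ j]) auto
  qed
  \<comment> \<open>Only the direction of \<open>w\<close> matters, so the weights need not be normalized.\<close>
  define w where "w x = (\<Sum>j\<in>J. \<psi> j x *\<^sub>R (q - e j))" for x
  have inner_w: "a F \<bullet> w x = (\<Sum>j\<in>J. \<psi> j x * (slack F (e j) - slack F q))" for F x
    by (simp add: w_def inner_sum_right inner_diff_right slack_def algebra_simps)
  have cont_w: "continuous_on P w"
    unfolding w_def \<psi>_def by (intro continuous_intros)
  have w_dir: "x0 + w x \<in> affine hull P" for x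
    unfolding w_def
  proof (rule add_sum_directions[OF x0P])
    show "x0 + (q - e j) \<in> affine hull P" for j
      using mem_affine_3_minus[OF affine_affine_hull hull_inc[OF x0P] q_mem e_mem[of j], of 1]
      by (simp add: algebra_simps)
  qed
  \<comment> \<open>The pieces active at \<open>x\<close> share a point \<open>z\<close> of
    \<open>P\<close>, so there are at most \<open>n\<close> of them. If \<open>w x = 0\<close>,
    dividing by the total weight \<open>S\<close> would make \<open>q\<close> a convex combination
    of their points \<open>e j\<close>, contrary to the choice of \<open>q\<close>.\<close>
  have w_nz: "w x \<noteq> 0" if x: "x \<in> P" for x
  proof
    assume "w x = 0"
    define I where "I = {j\<in>J. 0 < \<psi> j x}"
    have I: "I \<subseteq> J" "finite I"
      using J by (auto simp: I_def)
    obtain z where "z \<in> P" "\<forall>j\<in>J. infdist x (Y j) < \<delta> \<longrightarrow> z \<in> Y j"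
      using \<delta>(2)[OF x] by blast
    then have "card I \<le> card {j\<in>J. z \<in> Y j}" "card {j\<in>J. z \<in> Y j} \<le> n"
      using J mult by (auto simp: I_def \<psi>_pos intro!: card_mono)
    then have "q \<notin> affine hull (e ` I)"
      using q_off[OF I(1)] by simp
    define S where "S = (\<Sum>j\<in>I. \<psi> j x)"
    have "S > 0"
      unfolding S_def using \<psi>_sum[OF x] I(2) by (intro sum_pos) (auto simp: I_def)
    have "(\<Sum>j\<in>I. \<psi> j x *\<^sub>R (q - e j)) = w x"
      unfolding w_def I_def using J \<psi>_nonneg
      by (intro sum.mono_neutral_left) (auto simp: order_less_le)
    then have "S *\<^sub>R q = (\<Sum>j\<in>I. \<psi> j x *\<^sub>R e j)"
      using \<open>w x = 0\<close> by (simp add: S_def scaleR_diff_right sum_subtractf scaleR_sum_left)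
    then have "(1 / S) *\<^sub>R (S *\<^sub>R q) = (1 / S) *\<^sub>R (\<Sum>j\<in>I. \<psi> j x *\<^sub>R e j)"
      by simp
    then have "q = (\<Sum>j\<in>I. (\<psi> j x / S) *\<^sub>R e j)"
      using \<open>S > 0\<close> by (simp add: scaleR_sum_right)
    also have "\<dots> \<in> affine hull (e ` I)"
    proof (rule convex_sum[OF I(2)])
      show "convex (affine hull (e ` I))"
        by (simp add: affine_imp_convex)
      show "(\<Sum>j\<in>I. \<psi> j x / S) = 1"
        using \<open>S > 0\<close> by (simp add: S_def flip: sum_divide_distrib)
    qed (use \<open>S > 0\<close> \<psi>_nonneg in \<open>auto simp: hull_inc\<close>)
    finally show False
      using \<open>q \<notin> affine hull (e ` I)\<close> by simp
  qed
  obtain x s where x: "x \<in> rel_frontier P" and s: "0 < s" "x = x0 + s *\<^sub>R w x"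
    by (rule nonvanishing_field_radial_on_frontier[OF comp conv x0(1) cont_w w_dir w_nz])
  obtain G where G: "G facet_of P" "x \<in> G"
    using x rel_frontier_of_polyhedron[OF poly] by auto
  have xP: "x \<in> P"
    using G facet_of_imp_subset by blast
  obtain F where F: "F \<in> V" "h F = h G"
    using color_at_v[OF G(1)] by blast
  have slack_x: "slack F x = slack F x0 - s * (a F \<bullet> w x)"
    by (subst s(2)) (simp add: slack_def inner_add_right)
  obtain k where k: "k \<in> J" "0 < \<psi> k x"
    using \<psi>_sum[OF xP] by blast
  have active: "Y j \<inter> G \<noteq> {}" if "j \<in> J" "0 < \<psi> j x" for j
    using \<delta>(3)[of G x j] G that by (simp add: \<F>_def \<psi>_pos)
  show False
  proof (cases "F = G")
    case True
    \<comment> \<open>Every active piece meets \<open>G = F\<close>, so its \<open>e j\<close> has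
      slack \<open>0\<close>, below that of \<open>q\<close>. Hence the slack of \<open>F\<close> at
      \<open>x\<close> is at least its positive value at \<open>x0\<close>, although
      \<open>x\<close> lies on \<open>F\<close>.\<close>
    have "\<psi> j x * (slack F (e j) - slack F q) \<le> 0" if "j \<in> J" for j
      using slack_q[OF F(1)] slack_e[OF F(1), of j] active[OF that] \<psi>_nonneg[of j x] True
      by (cases "0 < \<psi> j x") (auto simp: mult_nonneg_nonpos)
    then have "a F \<bullet> w x \<le> 0"
      unfolding inner_w by (intro sum_nonpos) auto
    then have "s * (a F \<bullet> w x) \<le> 0"
      using s(1) by (simp add: mult_nonneg_nonpos)
    moreover have "slack F x = 0"
      using facet_eq[OF G(1) xP] G(2) True by (simp add: slack_def)
    ultimately show False
      using slack_x x0_pos[of F] VF(1)[OF F(1)] by simp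
  next
    case False
    \<comment> \<open>Every active piece meets \<open>G\<close> and therefore misses
      \<open>F\<close>, so its \<open>e j\<close> has slack \<open>1\<close>, above that of
      \<open>q\<close>. Hence the slack of \<open>F\<close> at \<open>x\<close> is at most its value
      at \<open>x0\<close>, which is below \<open>m\<close>, although \<open>x\<close> lies on
      \<open>G\<close>.\<close>
    have "0 \<le> \<psi> j x * (slack F (e j) - slack F q)" if "j \<in> J" for j
    proof (cases "0 < \<psi> j x")
      case True
      then have "Y j \<inter> F = {}"
        using no_two[OF that VF(1)[OF F(1)] G(1) False F(2)] active[OF that] by blast
      then show ?thesis
        using True slack_q[OF F(1)] slack_e[OF F(1), of j] by simp
    next
      case False
      then show ?thesis
        using \<psi>_nonneg[of j x] by simp
    qed
    then have "0 \<le> a F \<bullet> w x"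
      unfolding inner_w by (intro sum_nonneg) auto
    then have "slack F x \<le> slack F x0"
      using slack_x s(1) by simp
    then show False
      using m(2)[OF F(1) G(1) False F(2) G(2)] x0(2)[OF F(1)] by simp
  qed
qed

end

section \<open>Reduction to clopen pieces\<close>

theorem theorem3p1:
  fixes P :: "'a::euclidean_space set"
    and n N :: nat
    and h :: "'a set \<Rightarrow> nat"
    and X :: "nat \<Rightarrow> 'a set"
  assumes "simple_polytope n P"
    and "proper_coloring P n h"
    and "\<And>i. i \<in> {1..N} \<Longrightarrow> closed (X i)"
    and "P = (\<Union>i\<in>{1..N}. X i)"
    and "\<And>x. x \<in> P \<Longrightarrow> card {i \<in> {1..N}. x \<in> X i} \<le> n"
  shows "\<exists>i\<in>{1..N}. \<exists>C\<in>components (X i). \<exists>F G.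
           F facet_of P \<and> G facet_of P \<and> F \<noteq> G \<and> h F = h G \<and>
           C \<inter> F \<noteq> {} \<and> C \<inter> G \<noteq> {}"
proof -
  have polytope: "polytope P" and dim: "aff_dim P = int n"
    and simple: "\<And>v. v extreme_point_of P \<Longrightarrow> card {F. F facet_of P \<and> v \<in> F} = n"
    using assms(1) by (auto simp: simple_polytope_def)
  obtain a b where "polytope_inequalities P a b"
    using polytope_facet_inequalities[OF polytope] by blast
  then interpret polytope_inequalities P a b .
  have comp: "compact P"
    using polytope by (rule polytope_imp_compact)
  have finite_facets: "finite {F. F facet_of P}"
    using polytope by (rule finite_polytope_facets)
  have closed_facet: "closed F" if "F \<in> {F. F facet_of P}" for F
    using that comp polytope_imp_convex[OF polytope] face_of_imp_compact facet_of_imp_face_of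
      compact_imp_closed by blast
  have compX: "compact (X i)" if "i \<in> {1..N}" for i
    using assms(3)[OF that] assms(4) that comp compact_Int_closed[of P "X i"]
    by (metis Int_absorb1 UN_upper)
  have "\<exists>\<D>. finite \<D> \<and> pairwise disjnt \<D> \<and> \<Union>\<D> = X i \<and> (\<forall>D\<in>\<D>. closed D \<and>
      (\<exists>C\<in>components (X i). \<forall>F\<in>{F. F facet_of P}. D \<inter> F \<noteq> {} \<longrightarrow> C \<inter> F \<noteq> {}))"
    if "i \<in> {1..N}" for i
    by (rule compact_finite_clopen_partition[OF compX[OF that] finite_facets closed_facet]) blast+
  then obtain \<D> where \<D>: "\<And>i. i \<in> {1..N} \<Longrightarrow> finite (\<D> i) \<and> pairwise disjnt (\<D> i) \<and> \<Union>(\<D> i) = X i \<and>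
      (\<forall>D\<in>\<D> i. closed D \<and>
        (\<exists>C\<in>components (X i). \<forall>F\<in>{F. F facet_of P}. D \<inter> F \<noteq> {} \<longrightarrow> C \<inter> F \<noteq> {}))"
    by metis
  \<comment> \<open>Empty pieces are dropped because the library sets \<open>infdist x {} = 0\<close>.\<close>
  define J where "J = (SIGMA i:{1..N}. \<D> i - {{}})"
  have "\<exists>p\<in>J. \<exists>F G. F facet_of P \<and> G facet_of P \<and> F \<noteq> G \<and> h F = h G \<and>
      snd p \<inter> F \<noteq> {} \<and> snd p \<inter> G \<noteq> {}"
  proof (rule cover_member_meets_same_color_facets[OF dim simple assms(2)])
    show "finite J"
      unfolding J_def using \<D> by (intro finite_SigmaI) auto
    show "closed (snd p) \<and> snd p \<noteq> {}" if "p \<in> J" for p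
      using that \<D> by (auto simp: J_def)
    show "P \<subseteq> (\<Union>p\<in>J. snd p)"
    proof
      fix x assume "x \<in> P"
      then obtain i where i: "i \<in> {1..N}" "x \<in> X i"
        using assms(4) by blast
      then obtain D where "D \<in> \<D> i" "x \<in> D"
        using \<D>[OF i(1)] by blast
      then have "(i, D) \<in> J"
        using i(1) by (auto simp: J_def)
      then show "x \<in> (\<Union>p\<in>J. snd p)"
        using \<open>x \<in> D\<close> by force
    qed
    show "card {p \<in> J. x \<in> snd p} \<le> n" if x: "x \<in> P" for x
    proof -
      \<comment> \<open>The pieces of one \<open>X i\<close> are disjoint, so at most one of them
        contains \<open>x\<close>; cutting therefore does not raise the multiplicity of the
        cover.\<close>
      have "inj_on fst {p \<in> J. x \<in> snd p}"
      proof (rule inj_onI)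
        fix p p' assume p: "p \<in> {p \<in> J. x \<in> snd p}" "p' \<in> {p \<in> J. x \<in> snd p}" "fst p = fst p'"
        obtain i D D' where eqs: "p = (i, D)" "p' = (i, D')"
          using p(3) by (cases p, cases p') auto
        have "i \<in> {1..N}" "D \<in> \<D> i" "D' \<in> \<D> i" "\<not> disjnt D D'"
          using p by (auto simp: J_def eqs disjnt_def)
        then show "p = p'"
          using \<D>[of i] by (auto simp: eqs pairwise_def)
      qed
      moreover have "fst ` {p \<in> J. x \<in> snd p} \<subseteq> {i \<in> {1..N}. x \<in> X i}"
      proof
        fix i assume "i \<in> fst ` {p \<in> J. x \<in> snd p}"
        then obtain D where D: "(i, D) \<in> J" "x \<in> D"
          by auto
        then have "i \<in> {1..N}" "D \<in> \<D> i"
          by (simp_all add: J_def)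
        then show "i \<in> {i \<in> {1..N}. x \<in> X i}"
          using \<D>[of i] D(2) by blast
      qed
      ultimately have "card {p \<in> J. x \<in> snd p} \<le> card {i \<in> {1..N}. x \<in> X i}"
        by (intro card_inj_on_le) auto
      then show ?thesis
        using assms(5)[OF x] by simp
    qed
  qed
  then obtain i D F G where D: "i \<in> {1..N}" "D \<in> \<D> i"
    and FG: "F facet_of P" "G facet_of P" "F \<noteq> G" "h F = h G"
    and meets: "D \<inter> F \<noteq> {}" "D \<inter> G \<noteq> {}"
    unfolding J_def by fastforce
  \<comment> \<open>The single component \<open>C\<close> attached to \<open>D\<close> meets every
    facet that \<open>D\<close> meets, hence both \<open>F\<close> and \<open>G\<close>.\<close>
  obtain C where C: "C \<in> components (X i)"
    "\<forall>F\<in>{F. F facet_of P}. D \<inter> F \<noteq> {} \<longrightarrow> C \<inter> F \<noteq> {}"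
    using \<D>[OF D(1)] D(2) by blast
  then have "C \<inter> F \<noteq> {}" "C \<inter> G \<noteq> {}"
    using FG meets by simp_all
  then show ?thesis
    using D(1) C(1) FG by (intro bexI[of _ i] bexI[of _ C] exI[of _ F] exI[of _ G]) simp_all
qed

end
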